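(* Circumsphere rigidity is a generic property. That is, for every dimension $d\in\mathbb{N}$ and every $n\in\mathbb{N}$ (with $d,n\ge 1$), there is a Zariski open, dense subset $V$ of $\mathrm{PC}_{n,d}$ such that for any hypergraph $H$ with $n$ vertices and hyperedges each consisting of between $2$ and $d+1$ endpoints, either every circumsphere framework $(H,P)$ with $P\in V$ is (locally) rigid, or no circumsphere framework $(H,P)$ with $P\in V$ is (locally) rigid.
   Context: $\mathrm{PC}_{n,d}=\{(p_1,\dots,p_n)\in\mathbb{R}^{nd}: p_i\in\mathbb{R}^d,\ p_i\ne p_j \text{ for } i\neq j\}$; $[n]=\{1,\dots,n\}$. For $\sigma=\{i_1,\dots,i_k\}\subseteq[n]$, $\sigma(P)=(p_{i_1},\dots,p_{i_k})$. For a point cloud $R=(r_1,\dots,r_k)$, $\Lambda_R$ is the $k\times k$ matrix with entries $\|r_i-r_j\|^2$ (Euclidean distance matrix), and $\Delta_R=\begin{pmatrix}0&\theta^T\\ \theta&\Lambda_R\end{pmatrix}$ with $\theta$ the column vector of $k$ ones (Cayley–Menger matrix). A circumsphere framework in dimension $d$ is a pair $(H,P)$ with $P\in\mathrm{PC}_{n,d}$ and $H=([n],E)$ a hypergraph in which each hyperedge has between $2$ and $d+1$ endpoints. $(H,P)$ and $(H,Q)$ are equivalent if $$\det\Delta_{\sigma(P)}\det\Lambda_{\sigma(Q)}=\det\Delta_{\sigma(Q)}\det\Lambda_{\sigma(P)}\quad\text{for all }\sigma\in E.$$ $P$ and $Q$ are congruent if $\|p_i-p_j\|=\|q_i-q_j\|$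 for all $i,j\in[n]$. $(H,P)$ is (locally) rigid if there is a neighborhood $U$ of $P$ such that every $Q\in U$ with $(H,Q)$ equivalent to $(H,P)$ is congruent to $P$. *)

theory Defs
  imports "HOL-Analysis.Analysis" "Jordan_Normal_Form.Determinant"
begin

no_notation Matrix.vec_index (infixl \<open>$\<close> 100)

hide_const (open) Determinants.det Finite_Cartesian_Product.mat

definition zariski :: "'a::euclidean_space topology" where
  "zariski = topology (\<lambda>U. \<exists>F. (\<forall>f\<in>F. real_polynomial_function f) \<and> U = {x. \<exists>f\<in>F. f x \<noteq> 0})"

lemma istopology_zariski:
  "istopology (\<lambda>U::'a::euclidean_space set.
     \<exists>F. (\<forall>f\<in>F. real_polynomial_function f) \<and> U = {x. \<exists>f\<in>F. f x \<noteq> 0})"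
  (is "istopology ?Z")
  unfolding istopology_def
proof (intro conjI allI impI)
  fix U V assume "?Z U" "?Z V"
  then obtain F G where F: "\<forall>f\<in>F. real_polynomial_function f" "U = {x. \<exists>f\<in>F. f x \<noteq> 0}"
    and G: "\<forall>f\<in>G. real_polynomial_function f" "V = {x. \<exists>f\<in>G. f x \<noteq> 0}" by blast
  let ?H = "(\<lambda>(f, g) x. f x * g x) ` (F \<times> G)"
  have "\<forall>h\<in>?H. real_polynomial_function h"
    using F(1) G(1) by (auto intro: real_polynomial_function.intros(4))
  moreover have "U \<inter> V = {x. \<exists>h\<in>?H. h x \<noteq> 0}"
    using F(2) G(2) by auto
  ultimately show "?Z (U \<inter> V)" by (intro exI[of _ ?H] conjI)
next
  fix K assume K: "\<forall>U\<in>K. ?Z U"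
  let ?F = "{f. real_polynomial_function f \<and> {x. f x \<noteq> 0} \<subseteq> \<Union>K}"
  have "\<exists>f\<in>?F. f x \<noteq> 0" if x: "x \<in> U" and U: "U \<in> K" for x U
  proof -
    obtain F where F: "\<forall>f\<in>F. real_polynomial_function f" "U = {x. \<exists>f\<in>F. f x \<noteq> 0}"
      using K U by blast
    then obtain f where f: "f \<in> F" "f x \<noteq> 0" using x by auto
    then have "{x. f x \<noteq> 0} \<subseteq> U" using F(2) by auto
    then have "{x. f x \<noteq> 0} \<subseteq> \<Union>K" using U by (meson Union_upper subset_trans)
    then show ?thesis using f F(1) by auto
  qed
  then have "\<Union>K \<subseteq> {x. \<exists>f\<in>?F. f x \<noteq> 0}" by (intro subsetI CollectI) (elim UnionE)
  moreover have "{x. \<exists>f\<in>?F. f x \<noteq> 0} \<subseteq> \<Union>K" by (intro subsetI) (elim CollectE bexE conjE, erule subsetD, simp)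
  ultimately have "\<Union>K = {x. \<exists>f\<in>?F. f x \<noteq> 0}" by (rule subset_antisym)
  then show "?Z (\<Union>K)" by (intro exI[of _ ?F]) simp
qed

lemma openin_zariski:
  "openin zariski U \<longleftrightarrow>
     (\<exists>F. (\<forall>f\<in>F. real_polynomial_function f) \<and> U = {x. \<exists>f\<in>F. f x \<noteq> 0})"
  unfolding zariski_def by (simp add: topology_inverse'[OF istopology_zariski])

lemma open_if_openin_zariski:
  assumes "openin zariski U" shows "open U"
proof -
  obtain F where F: "\<forall>f\<in>F. real_polynomial_function f" and U: "U = {x. \<exists>f\<in>F. f x \<noteq> 0}"
    using assms unfolding openin_zariski by blast
  have "open {x. f x \<noteq> 0}" if "f \<in> F" for f
    using F that
    by (intro open_Collect_neq continuous_on_polymonial_function continuous_on_const)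
      (simp add: real_polynomial_function_eq)
  moreover have "U = (\<Union>f\<in>F. {x. f x \<noteq> 0})" using U by blast
  ultimately show ?thesis by auto
qed

lemma topspace_zariski [simp]: "topspace zariski = UNIV"
proof -
  have "openin zariski (UNIV :: 'a set)"
    unfolding openin_zariski
    by (rule exI[of _ "{\<lambda>_. 1}"]) (auto intro: real_polynomial_function.intros(2))
  then show ?thesis using openin_subset by blast
qed

text \<open>Density in the Euclidean topology entails density in the Zariski topology.\<close>

lemma zariski_dense_if_dense:
  assumes "V \<subseteq> S" "S \<subseteq> closure V"
  shows "subtopology zariski S closure_of V = S"
proof (intro subset_antisym subsetI)
  fix x assume "x \<in> subtopology zariski S closure_of V"
  then show "x \<in> S" by (simp add: in_closure_of)
next
  fix x assume x: "x \<in> S"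
  have "\<exists>y\<in>V. y \<in> U \<inter> S" if "openin zariski U" "x \<in> U" for U
  proof -
    have "U \<inter> closure V \<noteq> {}" using x assms(2) that(2) by auto
    then have "U \<inter> V \<noteq> {}"
      using open_Int_closure_eq_empty[OF open_if_openin_zariski[OF that(1)]] by simp
    then show ?thesis using assms(1) by auto
  qed
  then show "x \<in> subtopology zariski S closure_of V"
    unfolding in_closure_of openin_subtopology using x by auto
qed

text \<open>
  A point cloud of \<open>n\<close> points in \<open>\<real>\<^sup>d\<close> is a term of type \<open>real^'d^'n\<close> with
  \<open>n = CARD('n)\<close> and \<open>d = CARD('d)\<close>; the linear order on \<open>'n\<close> plays the
  role of the order on \<open>[n]\<close>. A hypergraph on \<open>[n]\<close> is given by its set of hyperedges.
\<close>

definition PC :: "(real^'d^'n) set" where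
  "PC = {P. \<forall>i j. i \<noteq> j \<longrightarrow> P $ i \<noteq> P $ j}"

definition subcloud :: "'n::{finite,linorder} set \<Rightarrow> real^'d^'n::{finite,linorder} \<Rightarrow> (real^'d) list" where
  "subcloud \<sigma> P = map (\<lambda>i. P $ i) (sorted_list_of_set \<sigma>)"

definition euclidean_distance_matrix :: "'a::real_normed_vector list \<Rightarrow> real mat" where
  "euclidean_distance_matrix R =
     mat (length R) (length R) (\<lambda>(i, j). (norm (R ! i - R ! j))\<^sup>2)"

definition cayley_menger_matrix :: "'a::real_normed_vector list \<Rightarrow> real mat" where
  "cayley_menger_matrix R =
     four_block_mat (0\<^sub>m 1 1) (mat 1 (length R) (\<lambda>_. 1))
                    (mat (length R) 1 (\<lambda>_. 1)) (euclidean_distance_matrix R)"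

definition admissible_hyperedges :: "'d::finite itself \<Rightarrow> 'n set set \<Rightarrow> bool" where
  "admissible_hyperedges _ E \<longleftrightarrow> (\<forall>\<sigma>\<in>E. 2 \<le> card \<sigma> \<and> card \<sigma> \<le> CARD('d) + 1)"

definition circumsphere_framework :: "'n::finite set set \<Rightarrow> real^'d^'n \<Rightarrow> bool" where
  "circumsphere_framework E P \<longleftrightarrow> P \<in> PC \<and> admissible_hyperedges TYPE('d) E"

definition equivalent_frameworks ::
    "'n::{finite,linorder} set set \<Rightarrow> real^'d^'n::{finite,linorder} \<Rightarrow> real^'d^'n::{finite,linorder} \<Rightarrow> bool" where
  "equivalent_frameworks E P Q \<longleftrightarrow>
     (\<forall>\<sigma>\<in>E. det (cayley_menger_matrix (subcloud \<sigma> P)) * det (euclidean_distance_matrix (subcloud \<sigma> Q))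
           = det (cayley_menger_matrix (subcloud \<sigma> Q)) * det (euclidean_distance_matrix (subcloud \<sigma> P)))"

definition congruent_clouds :: "real^'d^'n \<Rightarrow> real^'d^'n \<Rightarrow> bool" where
  "congruent_clouds P Q \<longleftrightarrow> (\<forall>i j. norm (P $ i - P $ j) = norm (Q $ i - Q $ j))"

definition locally_rigid :: "'n::{finite,linorder} set set \<Rightarrow> real^'d^'n::{finite,linorder} \<Rightarrow> bool" where
  "locally_rigid E P \<longleftrightarrow>
     (\<exists>U. open U \<and> P \<in> U \<and>
        (\<forall>Q\<in>U. circumsphere_framework E Q \<and> equivalent_frameworks E P Q \<longrightarrow> congruent_clouds P Q))"

end

theory Submission
  imports Defs
begin

text \<open>
  For a hyperedge \<open>\<sigma>\<close> let \<open>f\<^sub>\<sigma>\<close> be the Cayley--Menger determinant and \<open>g\<^sub>\<sigma>\<close> the determinant of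
  the Euclidean distance matrix, both polynomials in the coordinates of the point cloud. Where
  \<open>f\<^sub>\<sigma>\<close> does not vanish, equivalence of frameworks says that the rational functions
  \<open>h\<^sub>\<sigma> = g\<^sub>\<sigma> / f\<^sub>\<sigma>\<close> take the same values, while congruence says that the squared distances
  \<open>D\<^sub>i\<^sub>j\<close> do. Hence local rigidity at \<open>P\<close> means that near \<open>P\<close> the fibre of \<open>(h\<^sub>\<sigma>)\<close> through
  \<open>P\<close> lies in a fibre of \<open>(D\<^sub>i\<^sub>j)\<close>, and this is decided by linear algebra on gradients as soon as
  their ranks are constant.

  Up to a nonzero factor the gradient of \<open>h\<^sub>\<sigma>\<close> is the polynomial vector field
  \<open>w\<^sub>\<sigma> = f\<^sub>\<sigma> \<nabla>g\<^sub>\<sigma> - g\<^sub>\<sigma> \<nabla>f\<^sub>\<sigma>\<close>. Linear independence of polynomial vector fields is the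
  nonvanishing of one polynomial (\<open>independence_polynomial\<close>), so a family \<open>B\<close> of hyperedges that
  is maximal among those with \<open>w\<^sub>b\<close>, \<open>b \<in> B\<close>, independent at some point stays independent, and
  keeps spanning all other \<open>w\<^sub>\<sigma>\<close>, on a nonempty Zariski open set.

  There are two cases. If every \<open>\<nabla>D\<^sub>i\<^sub>j\<close> lies in the span of the \<open>w\<^sub>b\<close> throughout this set, then
  each \<open>D\<^sub>i\<^sub>j\<close> is locally constant on the level sets of the \<open>h\<^sub>b\<close>
  (\<open>dependent_function_constant_on_level_set\<close>): all generic frameworks are rigid. If some
  \<open>\<nabla>D\<^sub>i\<^sub>j\<close> leaves the span at one point, it does so on a smaller nonempty Zariski open set, and
  a curve inside the fibre changes \<open>D\<^sub>i\<^sub>j\<close> to first order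
  (\<open>independent_function_varies_on_level_set\<close>): no generic framework is rigid. There are finitely
  many hypergraphs on a finite vertex set, and nonempty Zariski open sets are dense, so the product
  of the polynomials found for the individual hypergraphs gives one \<open>V\<close> for all of them.
\<close>

section \<open>Polynomial functions\<close>

lemma real_polynomial_function_inner:
  fixes u v :: "'a::real_normed_vector \<Rightarrow> 'b::euclidean_space"
  assumes "polynomial_function u" "polynomial_function v"
  shows "real_polynomial_function (\<lambda>x. inner (u x) (v x))"
proof -
  have "real_polynomial_function (\<lambda>x. \<Sum>b\<in>Basis. inner (u x) b * inner (v x) b)"
    using assms unfolding real_polynomial_function_eq
    by (intro polynomial_function_sum polynomial_function_mult[where 'b=real, simplified]
        polynomial_function_inner) auto
  then show ?thesis by (simp add: euclidean_inner[symmetric])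
qed

lemma real_polynomial_function_gradient:
  fixes p :: "'a::euclidean_space \<Rightarrow> real"
  assumes "real_polynomial_function p"
  obtains G where "polynomial_function G" "\<And>x. (p has_derivative (\<lambda>v. inner (G x) v)) (at x)"
proof -
  have "\<exists>G. polynomial_function G \<and> (\<forall>x. (p has_derivative (\<lambda>v. inner (G x) v)) (at x))"
    using assms
  proof (induction p rule: real_polynomial_function.induct)
    case (linear f)
    define w where "w = (\<Sum>b\<in>Basis. f b *\<^sub>R b)"
    have "f v = inner w v" for v
    proof -
      have "f v = f (\<Sum>b\<in>Basis. inner v b *\<^sub>R b)" by (simp add: euclidean_representation)
      also have "\<dots> = (\<Sum>b\<in>Basis. inner v b * f b)"
        using linear by (simp add: bounded_linear.linear linear_sum linear_cmul)
      also have "\<dots> = inner w v"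
        by (simp add: w_def inner_sum_left inner_commute[of v] mult.commute)
      finally show ?thesis .
    qed
    then have "f = (\<lambda>v. inner w v)" by auto
    then have "(f has_derivative (\<lambda>v. inner w v)) (at x)" for x
      using bounded_linear_imp_has_derivative[OF linear] by simp
    then show ?case by (intro exI[of _ "\<lambda>_. w"]) auto
  next
    case (const c)
    then show ?case by (intro exI[of _ "\<lambda>_. 0"]) auto
  next
    case (add f g)
    then obtain F G where "polynomial_function F" "\<And>x. (f has_derivative (\<lambda>v. inner (F x) v)) (at x)"
      "polynomial_function G" "\<And>x. (g has_derivative (\<lambda>v. inner (G x) v)) (at x)" by blast
    then show ?case
      by (intro exI[of _ "\<lambda>x. F x + G x"])
        (auto simp: inner_add_left intro!: has_derivative_add)
  next
    case (mult f g)
    then obtain F G where FG: "polynomial_function F" "\<And>x. (f has_derivative (\<lambda>v. inner (F x) v)) (at x)"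
      "polynomial_function G" "\<And>x. (g has_derivative (\<lambda>v. inner (G x) v)) (at x)" by blast
    have "((\<lambda>x. f x * g x) has_derivative (\<lambda>v. inner (f x *\<^sub>R G x + g x *\<^sub>R F x) v)) (at x)" for x
      using has_derivative_mult[OF FG(2)[of x] FG(4)[of x]]
      by (simp add: inner_add_left mult.commute)
    moreover have "polynomial_function (\<lambda>x. f x *\<^sub>R G x + g x *\<^sub>R F x)"
      using FG mult by (auto simp: real_polynomial_function_eq)
    ultimately show ?case by (intro exI[of _ "\<lambda>x. f x *\<^sub>R G x + g x *\<^sub>R F x"]) auto
  qed
  then show ?thesis using that by blast
qed

text \<open>
  On the line from an arbitrary point \<open>x\<close> to the point \<open>a\<close> the polynomial restricts to a nonzero
  polynomial in one variable, which has finitely many roots; so \<open>x\<close> is a limit of points of that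
  line where \<open>p\<close> does not vanish.
\<close>

lemma closure_nonzero_polynomial:
  fixes p :: "'a::euclidean_space \<Rightarrow> real"
  assumes p: "real_polynomial_function p" and a: "p a \<noteq> 0"
  shows "closure {x. p x \<noteq> 0} = UNIV"
proof -
  have "x \<in> closure {x. p x \<noteq> 0}" for x
  proof -
    define l where "l t = x + t *\<^sub>R (a - x)" for t :: real
    have l: "polynomial_function l"
      unfolding l_def real_polynomial_function_eq
      by (intro polynomial_function_add polynomial_function_const polynomial_function_bounded_linear
          bounded_linear_scaleR_left)
    have "real_polynomial_function (p \<circ> l)"
      using l p by (rule real_polynomial_function_compose)
    then obtain c n where c: "p \<circ> l = (\<lambda>t. \<Sum>i\<le>n. c i * t ^ i)"
      by (auto simp: real_polynomial_function_iff_sum)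
    have "(p \<circ> l) 1 \<noteq> 0" using a by (simp add: l_def)
    then have "\<exists>i\<le>n. c i \<noteq> 0" unfolding c by (metis (no_types, lifting) atMost_iff mult_zero_left sum.neutral)
    then have fin: "finite {t. p (l t) = 0}"
      using polyfun_finite_roots[where n=n and c=c] c by (simp add: o_def fun_eq_iff)
    have "0 islimpt ({t. p (l t) = 0} \<union> (UNIV - {t. p (l t) = 0}))" by simp
    then have "0 islimpt (UNIV - {t. p (l t) = 0})" by (simp only: islimpt_Un_finite[OF fin])
    then have "0 \<in> closure (UNIV - {t. p (l t) = 0})" by (simp add: closure_def)
    then have "l 0 \<in> l ` closure (UNIV - {t. p (l t) = 0})" by blast
    also have "\<dots> \<subseteq> closure (l ` (UNIV - {t. p (l t) = 0}))"
      using continuous_on_polymonial_function[OF l]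
      by (intro image_closure_subset) (auto intro: closure_subset[THEN subsetD])
    also have "\<dots> \<subseteq> closure {x. p x \<noteq> 0}" by (intro closure_mono) auto
    finally show ?thesis by (simp add: l_def)
  qed
  then show ?thesis by auto
qed

text \<open>
  Polynomial functions on a Euclidean space form an integral domain, because a dense set meets a
  nonempty open one.
\<close>

lemma prod_nonzero_polynomials:
  fixes p :: "'k \<Rightarrow> 'a::euclidean_space \<Rightarrow> real"
  assumes "finite K" "\<And>k. k \<in> K \<Longrightarrow> real_polynomial_function (p k)"
    and "\<And>k. k \<in> K \<Longrightarrow> \<exists>x. p k x \<noteq> 0"
  shows "\<exists>x. (\<Prod>k\<in>K. p k x) \<noteq> 0"
  using assms
proof (induction K rule: finite_induct)
  case (insert k K)
  let ?q = "\<lambda>x. \<Prod>k\<in>K. p k x"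
  have q: "real_polynomial_function ?q"
    using insert by (intro real_polynomial_function_prod) auto
  have "open {x. p k x \<noteq> 0}"
    using insert.prems(1)[of k] unfolding real_polynomial_function_eq
    by (intro open_Collect_neq continuous_on_polymonial_function continuous_on_const) auto
  moreover obtain y where "?q y \<noteq> 0" using insert by auto
  then have "closure {x. ?q x \<noteq> 0} = UNIV" by (rule closure_nonzero_polynomial[OF q])
  moreover have "{x. p k x \<noteq> 0} \<noteq> {}" using insert.prems(2)[of k] by auto
  ultimately have "{x. p k x \<noteq> 0} \<inter> {x. ?q x \<noteq> 0} \<noteq> {}"
    using open_Int_closure_eq_empty[of "{x. p k x \<noteq> 0}" "{x. ?q x \<noteq> 0}"] by auto
  then show ?case using insert by auto
qed simp

lemma nonzero_mult_polynomials:
  fixes p q :: "'a::euclidean_space \<Rightarrow> real"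
  assumes "real_polynomial_function p" "real_polynomial_function q" "p a \<noteq> 0" "q b \<noteq> 0"
  shows "\<exists>x. p x * q x \<noteq> 0"
proof -
  have "\<exists>x. (\<Prod>k\<in>UNIV. (if k then p else q) x) \<noteq> 0"
    using assms by (intro prod_nonzero_polynomials) (auto split: if_splits)
  then show ?thesis by (simp add: UNIV_bool mult.commute)
qed

section \<open>Generic linear independence\<close>

text \<open>
  The vectors \<open>e c\<close> form a dual system. For finite \<open>B\<close> its existence is equivalent to linear
  independence of the family together with injectivity of \<open>w\<close> on \<open>B\<close>. The dual form is preserved
  under nonzero rescaling of the vectors by inspection, and it supplies the vectors needed to
  build a local coordinate system from functions with independent gradients.
\<close>

definition independent_family :: "('k \<Rightarrow> 'a::euclidean_space) \<Rightarrow> 'k set \<Rightarrow> bool" where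
  "independent_family w B \<longleftrightarrow> (\<exists>e. \<forall>b\<in>B. \<forall>c\<in>B. inner (w b) (e c) = (if b = c then 1 else 0))"

lemma inner_span_eq_0:
  fixes u :: "'a::euclidean_space"
  assumes "a \<in> span S" "\<And>s. s \<in> S \<Longrightarrow> inner s u = 0"
  shows "inner a u = 0"
  using orthogonal_to_span[OF assms(1), of u] assms(2)
  by (simp add: real_inner_class.orthogonal_def inner_commute)

lemma vector_outside_span:
  fixes x :: "'a::euclidean_space"
  assumes "x \<notin> span S"
  obtains u where "\<And>s. s \<in> span S \<Longrightarrow> inner s u = 0" "inner x u \<noteq> 0"
proof -
  obtain y z where yz: "y \<in> span S" "\<And>w. w \<in> span S \<Longrightarrow> real_inner_class.orthogonal z w" "x = y + z"
    using orthogonal_subspace_decomp_exists[of S x] by metis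
  have "z \<noteq> 0" using assms yz by auto
  moreover have "inner x z = inner z z"
    using yz(2)[OF yz(1)] by (simp add: yz(3) inner_add_left real_inner_class.orthogonal_def inner_commute[of y z])
  ultimately show ?thesis
    using yz(2) by (intro that[of z]) (auto simp: real_inner_class.orthogonal_def inner_commute)
qed

text \<open>
  The extra dual vector is a multiple of a vector orthogonal to the span of \<open>w ` B\<close> but not to
  \<open>w k\<close>; the old dual vectors are then corrected to be orthogonal to \<open>w k\<close>.
\<close>

lemma independent_family_insert:
  assumes "k \<notin> B"
  shows "independent_family w (insert k B) \<longleftrightarrow> independent_family w B \<and> w k \<notin> span (w ` B)"
proof
  assume "independent_family w (insert k B)"
  then obtain e where e: "\<forall>b\<in>insert k B. \<forall>c\<in>insert k B. inner (w b) (e c) = (if b = c then 1 else 0)"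
    unfolding independent_family_def by blast
  then have "independent_family w B" unfolding independent_family_def by (intro exI[of _ e]) auto
  moreover have "w k \<notin> span (w ` B)"
  proof
    assume *: "w k \<in> span (w ` B)"
    have "inner (w k) (e k) = 0"
      by (rule inner_span_eq_0[OF *]) (use e assms in auto)
    then show False using e by simp
  qed
  ultimately show "independent_family w B \<and> w k \<notin> span (w ` B)" ..
next
  assume *: "independent_family w B \<and> w k \<notin> span (w ` B)"
  then obtain e where e: "\<forall>b\<in>B. \<forall>c\<in>B. inner (w b) (e c) = (if b = c then 1 else 0)"
    unfolding independent_family_def by blast
  obtain u where u: "\<And>s. s \<in> span (w ` B) \<Longrightarrow> inner s u = 0" "inner (w k) u \<noteq> 0"
    using vector_outside_span * by metis
  have u': "b \<in> B \<Longrightarrow> inner (w b) u = 0" for b by (intro u(1) span_base) auto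
  define ek where "ek = (1 / inner (w k) u) *\<^sub>R u"
  show "independent_family w (insert k B)"
    unfolding independent_family_def
    using assms e u(2) u'
    by (intro exI[of _ "\<lambda>c. if c = k then ek else e c - inner (w k) (e c) *\<^sub>R ek"])
      (auto simp: ek_def inner_diff_right)
qed

lemma independent_family_scale:
  assumes "independent_family w B" "\<And>b. b \<in> B \<Longrightarrow> s b \<noteq> 0"
  shows "independent_family (\<lambda>b. s b *\<^sub>R w b) B"
proof -
  obtain e where "\<forall>b\<in>B. \<forall>c\<in>B. inner (w b) (e c) = (if b = c then 1 else 0)"
    using assms(1) unfolding independent_family_def by blast
  then show ?thesis
    unfolding independent_family_def using assms(2)
    by (intro exI[of _ "\<lambda>c. (1 / s c) *\<^sub>R e c"]) auto
qed

lemma span_scaled_family: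
  fixes w :: "'k \<Rightarrow> 'a::euclidean_space"
  assumes "\<And>b. b \<in> B \<Longrightarrow> s b \<noteq> 0"
  shows "span ((\<lambda>b. s b *\<^sub>R w b) ` B) = span (w ` B)"
proof (rule subset_antisym)
  show "span ((\<lambda>b. s b *\<^sub>R w b) ` B) \<subseteq> span (w ` B)"
    by (intro span_minimal) (auto intro: span_scale span_base)
  have "w b \<in> span ((\<lambda>b. s b *\<^sub>R w b) ` B)" if "b \<in> B" for b
  proof -
    have "(1 / s b) *\<^sub>R (s b *\<^sub>R w b) \<in> span ((\<lambda>b. s b *\<^sub>R w b) ` B)"
      using that by (intro span_scale span_base) auto
    then show ?thesis using assms[OF that] by simp
  qed
  then show "span (w ` B) \<subseteq> span ((\<lambda>b. s b *\<^sub>R w b) ` B)"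
    by (intro span_minimal) auto
qed

text \<open>
  Gram--Schmidt orthogonalisation without divisions. The statement about \<open>p\<close> alone does not carry
  the induction: the step also needs \<open>u\<close>, which is the component of \<open>v\<close> orthogonal to the vectors
  \<open>w b x\<close>, cleared of denominators by the factor \<open>p\<close>. A new vector is independent of the old ones
  if and only if its orthogonal component does not vanish. The resulting \<open>p\<close> is a product
  of powers of Gram determinants of initial subfamilies.
\<close>

lemma independence_polynomial:
  fixes w :: "'k \<Rightarrow> 'a::euclidean_space \<Rightarrow> 'b::euclidean_space"
  assumes "finite B" "\<And>b. b \<in> B \<Longrightarrow> polynomial_function (w b)"
  shows "\<exists>p. real_polynomial_function p \<and>
    (\<forall>x. p x \<noteq> 0 \<longleftrightarrow> independent_family (\<lambda>b. w b x) B) \<and>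
    (\<forall>v. polynomial_function v \<longrightarrow> (\<exists>u. polynomial_function u \<and>
      (\<forall>x. p x *\<^sub>R v x - u x \<in> span ((\<lambda>b. w b x) ` B) \<and> (\<forall>b\<in>B. inner (w b x) (u x) = 0))))"
  using assms
proof (induction B rule: finite_induct)
  case empty
  have "\<exists>u. polynomial_function u \<and> (\<forall>x. v x = u x)" if "polynomial_function v" for v :: "'a \<Rightarrow> 'b"
    using that by blast
  then show ?case
    by (intro exI[of _ "\<lambda>_. 1"]) (auto simp: independent_family_def)
next
  case (insert k B)
  then obtain p where p: "real_polynomial_function p"
    and ind: "\<And>x. p x \<noteq> 0 \<longleftrightarrow> independent_family (\<lambda>b. w b x) B"
    and proj: "\<And>v. polynomial_function v \<Longrightarrow> \<exists>u. polynomial_function u \<and>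
      (\<forall>x. p x *\<^sub>R v x - u x \<in> span ((\<lambda>b. w b x) ` B) \<and> (\<forall>b\<in>B. inner (w b x) (u x) = 0))"
    by auto
  let ?S = "\<lambda>x. span ((\<lambda>b. w b x) ` B)" and ?T = "\<lambda>x. span ((\<lambda>b. w b x) ` insert k B)"
  obtain u where u: "polynomial_function u"
    and u_span: "\<And>x. p x *\<^sub>R w k x - u x \<in> ?S x" and u_orth: "\<And>x b. b \<in> B \<Longrightarrow> inner (w b x) (u x) = 0"
    using proj[of "w k"] insert.prems by auto
  have u_orth': "inner s (u x) = 0" if "s \<in> ?S x" for s x
    using inner_span_eq_0[OF that] u_orth by auto
  have wk_u: "p x * inner (w k x) (u x) = inner (u x) (u x)" for x
    using u_orth'[OF u_span[of x]] by (simp add: inner_diff_left)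
  have ST: "?S x \<subseteq> ?T x" for x by (intro span_mono) auto
  have uT: "u x \<in> ?T x" for x
  proof -
    have "p x *\<^sub>R w k x \<in> ?T x" by (intro span_scale span_base) auto
    moreover have "p x *\<^sub>R w k x - u x \<in> ?T x" using u_span[of x] ST[of x] by blast
    ultimately have "p x *\<^sub>R w k x - (p x *\<^sub>R w k x - u x) \<in> ?T x" by (rule span_diff)
    then show ?thesis by simp
  qed
  \<comment> \<open>One factor \<open>p x\<close> would suffice for independence. The second one makes \<open>u'\<close> below orthogonal
     to \<open>w k x\<close> also at the zeros of \<open>p\<close>, where \<open>u x\<close> is no longer tied to \<open>w k x\<close>.\<close>
  define p' where "p' x = p x * p x * inner (u x) (u x)" for x
  have p': "real_polynomial_function p'"
    unfolding p'_def using p u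
    by (intro real_polynomial_function.intros(4) real_polynomial_function_inner)
  have ind': "p' x \<noteq> 0 \<longleftrightarrow> independent_family (\<lambda>b. w b x) (insert k B)" for x
  proof -
    have "u x = 0 \<longleftrightarrow> w k x \<in> ?S x" if "p x \<noteq> 0"
    proof
      assume "u x = 0"
      then have "p x *\<^sub>R w k x \<in> ?S x" using u_span[of x] by simp
      then have "(1 / p x) *\<^sub>R (p x *\<^sub>R w k x) \<in> ?S x" by (rule span_scale)
      then show "w k x \<in> ?S x" using that by simp
    next
      assume "w k x \<in> ?S x"
      then show "u x = 0" using u_orth'[of "w k x" x] wk_u[of x] by simp
    qed
    then show ?thesis
      using ind[of x] independent_family_insert[OF insert.hyps(2), of "\<lambda>b. w b x"]
      by (auto simp: p'_def)
  qed
  have "\<exists>u'. polynomial_function u' \<and>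
      (\<forall>x. p' x *\<^sub>R v x - u' x \<in> ?T x \<and> (\<forall>b\<in>insert k B. inner (w b x) (u' x) = 0))"
    if v: "polynomial_function v" for v
  proof -
    obtain y where y: "polynomial_function y"
      and y_span: "\<And>x. p x *\<^sub>R v x - y x \<in> ?S x" and y_orth: "\<And>x b. b \<in> B \<Longrightarrow> inner (w b x) (y x) = 0"
      using proj[OF v] by auto
    have y_orth': "inner s (y x) = 0" if "s \<in> ?S x" for s x
      using inner_span_eq_0[OF that] y_orth by auto
    have wk_y: "p x * inner (w k x) (y x) = inner (u x) (y x)" for x
      using y_orth'[OF u_span[of x]] by (simp add: inner_diff_left)
    define u' where "u' x = p x *\<^sub>R (inner (u x) (u x) *\<^sub>R y x - inner (u x) (y x) *\<^sub>R u x)" for x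
    have "polynomial_function u'"
      unfolding u'_def using p u y real_polynomial_function_inner[OF u y] real_polynomial_function_inner[OF u u]
      by (intro polynomial_function_mult polynomial_function_diff) (auto simp: real_polynomial_function_eq)
    moreover have "p' x *\<^sub>R v x - u' x \<in> ?T x" for x
    proof -
      have "p' x *\<^sub>R v x - u' x =
          (p x * inner (u x) (u x)) *\<^sub>R (p x *\<^sub>R v x - y x) + (p x * inner (u x) (y x)) *\<^sub>R u x"
        by (simp add: p'_def u'_def algebra_simps)
      also have "\<dots> \<in> ?T x" using y_span[of x] ST uT by (intro span_add span_scale) auto
      finally show ?thesis .
    qed
    moreover have "inner (w b x) (u' x) = 0" if "b \<in> insert k B" for b x
    proof (cases "b = k")
      case True
      have "inner (w k x) (u' x) = inner (u x) (u x) * (p x * inner (w k x) (y x))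
          - inner (u x) (y x) * (p x * inner (w k x) (u x))"
        by (simp add: u'_def inner_diff_right algebra_simps)
      then show ?thesis unfolding wk_u wk_y True by simp
    next
      case False
      then show ?thesis using that y_orth u_orth by (simp add: u'_def inner_diff_right)
    qed
    ultimately show ?thesis by blast
  qed
  then show ?case using p' ind' by blast
qed

section \<open>Level sets of functions with independent gradients\<close>

text \<open>
  A local change of coordinates that makes all \<open>h b\<close> linear at once. With \<open>e\<close> dual to the gradients
  at \<open>P\<close>, put \<open>\<Phi> x = x + (\<Sum>c\<in>B. (h c x - inner (G c P) x) *\<^sub>R e c)\<close>. Its derivative at \<open>P\<close> is the
  identity, so the inverse function theorem applies, and taking the inner product with \<open>G b P\<close>
  leaves exactly \<open>h b x\<close>.
\<close>

lemma straighten_independent_functions: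
  fixes h :: "'k \<Rightarrow> 'a::euclidean_space \<Rightarrow> real" and G :: "'k \<Rightarrow> 'a \<Rightarrow> 'a"
  assumes B: "finite B" and W: "open W" "P \<in> W"
    and der: "\<And>b x. b \<in> B \<Longrightarrow> x \<in> W \<Longrightarrow> (h b has_derivative (\<lambda>v. inner (G b x) v)) (at x)"
    and cont: "\<And>b. b \<in> B \<Longrightarrow> continuous_on W (G b)"
    and ind: "independent_family (\<lambda>b. G b P) B"
  obtains U V \<Phi> \<Psi> \<Psi>' where "open U" "U \<subseteq> W" "P \<in> U" "open V" "homeomorphism U V \<Phi> \<Psi>"
    "\<And>y. y \<in> V \<Longrightarrow> (\<Psi> has_derivative \<Psi>' y) (at y)" "\<Psi>' (\<Phi> P) = id"
    "\<And>b x. b \<in> B \<Longrightarrow> h b x = inner (G b P) (\<Phi> x)"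
proof -
  obtain e where e: "\<forall>b\<in>B. \<forall>c\<in>B. inner (G b P) (e c) = (if b = c then 1 else 0)"
    using ind unfolding independent_family_def by blast
  define \<Phi> where "\<Phi> x = x + (\<Sum>c\<in>B. (h c x - inner (G c P) x) *\<^sub>R e c)" for x
  define \<Phi>' where "\<Phi>' x = id_blinfun +
    (\<Sum>c\<in>B. blinfun_scaleR_left (e c) o\<^sub>L blinfun_inner_left (G c x - G c P))" for x
  have \<Phi>'_apply: "blinfun_apply (\<Phi>' x) = (\<lambda>v. v + (\<Sum>c\<in>B. (inner (G c x) v - inner (G c P) v) *\<^sub>R e c))" for x
    by (auto simp: \<Phi>'_def blinfun.bilinear_simps blinfun.sum_left inner_diff_left inner_diff_right fun_eq_iff inner_commute
        intro!: sum.cong)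
  have "(\<Phi> has_derivative blinfun_apply (\<Phi>' x)) (at x)" if "x \<in> W" for x
    unfolding \<Phi>_def \<Phi>'_apply using der that by (auto intro!: derivative_eq_intros)
  moreover have "continuous_on W \<Phi>'"
    unfolding \<Phi>'_def using cont by (intro continuous_intros) auto
  moreover have id: "\<Phi>' P = id_blinfun" by (rule blinfun_eqI) (simp add: \<Phi>'_apply)
  moreover have id_comp: "id_blinfun o\<^sub>L \<Phi>' P = id_blinfun" by (rule blinfun_eqI) (simp add: id)
  ultimately obtain U V \<Psi> \<Psi>' where *: "open U" "U \<subseteq> W" "P \<in> U" "open V" "\<Phi> P \<in> V"
      "homeomorphism U V \<Phi> \<Psi>" "\<And>y. y \<in> V \<Longrightarrow> (\<Psi> has_derivative \<Psi>' y) (at y)"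
      "\<And>y. y \<in> V \<Longrightarrow> \<Psi>' y = inv_into UNIV (blinfun_apply (\<Phi>' (\<Psi> y)))"
    using inverse_function_theorem[of W \<Phi> \<Phi>' P id_blinfun] W id_comp by metis
  have "\<Psi> (\<Phi> P) = P" using *(3,6) by (simp add: homeomorphism_def)
  moreover have "blinfun_apply id_blinfun = (id :: 'a \<Rightarrow> 'a)" by auto
  ultimately have "\<Psi>' (\<Phi> P) = id" using *(8)[OF *(5)] id by simp
  moreover have "h b x = inner (G b P) (\<Phi> x)" if "b \<in> B" for b x
  proof -
    have "inner (G b P) (\<Phi> x) = inner (G b P) x + (\<Sum>c\<in>B. (h c x - inner (G c P) x) * (if b = c then 1 else 0))"
      using e that by (simp add: \<Phi>_def inner_add_right inner_sum_right)
    also have "(\<Sum>c\<in>B. (h c x - inner (G c P) x) * (if b = c then 1 else 0)) = h b x - inner (G b P) x"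
      using that B by (simp add: if_distrib cong: if_cong)
    finally show ?thesis by simp
  qed
  ultimately show ?thesis using * that by blast
qed

text \<open>
  In straightened coordinates the level set of the \<open>h b\<close> is an affine subspace, so two of its points
  close to \<open>P\<close> are joined by a segment inside it. Along the segment the velocity is orthogonal to all
  \<open>G b\<close>, hence to their combination \<open>\<Gamma>\<close>, and \<open>g\<close> has derivative zero.
\<close>

lemma dependent_function_constant_on_level_set:
  fixes h :: "'k \<Rightarrow> 'a::euclidean_space \<Rightarrow> real" and G :: "'k \<Rightarrow> 'a \<Rightarrow> 'a"
  assumes B: "finite B" and W: "open W" "P \<in> W"
    and der: "\<And>b x. b \<in> B \<Longrightarrow> x \<in> W \<Longrightarrow> (h b has_derivative (\<lambda>v. inner (G b x) v)) (at x)"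
    and cont: "\<And>b. b \<in> B \<Longrightarrow> continuous_on W (G b)"
    and ind: "independent_family (\<lambda>b. G b P) B"
    and derg: "\<And>x. x \<in> W \<Longrightarrow> (g has_derivative (\<lambda>v. inner (\<Gamma> x) v)) (at x)"
    and dep: "\<And>x. x \<in> W \<Longrightarrow> \<Gamma> x \<in> span ((\<lambda>b. G b x) ` B)"
  shows "\<exists>U. open U \<and> P \<in> U \<and> (\<forall>Q\<in>U. (\<forall>b\<in>B. h b Q = h b P) \<longrightarrow> g Q = g P)"
proof -
  obtain U V \<Phi> \<Psi> \<Psi>' where U: "open U" "U \<subseteq> W" "P \<in> U" and V: "open V" and hom: "homeomorphism U V \<Phi> \<Psi>"
    and der\<Psi>: "\<And>y. y \<in> V \<Longrightarrow> (\<Psi> has_derivative \<Psi>' y) (at y)"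
    and h: "\<And>b x. b \<in> B \<Longrightarrow> h b x = inner (G b P) (\<Phi> x)"
    using straighten_independent_functions[OF B W der cont ind] by metis
  have "\<Phi> P \<in> V" using hom U by (auto simp: homeomorphism_def)
  then obtain r where r: "r > 0" "ball (\<Phi> P) r \<subseteq> V" using V by (meson open_contains_ball)
  define N where "N = U \<inter> \<Phi> -` ball (\<Phi> P) r"
  have N: "open N" "P \<in> N"
    unfolding N_def using hom U r
    by (auto intro!: continuous_open_preimage simp: homeomorphism_def)
  have "g Q = g P" if Q: "Q \<in> N" and eq: "\<forall>b\<in>B. h b Q = h b P" for Q
  proof -
    define y where "y t = \<Phi> P + t *\<^sub>R (\<Phi> Q - \<Phi> P)" for t :: real
    \<comment> \<open>An open interval around the unit interval, so that two-sided derivatives exist also at its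
       end points.\<close>
    define T where "T = y -` ball (\<Phi> P) r"
    have y_cont: "continuous_on UNIV y" unfolding y_def by (intro continuous_intros)
    have T_open: "open T"
      unfolding T_def using y_cont by (intro open_vimage) auto
    have T_convex: "convex T"
    proof -
      have "T = (\<lambda>t. t *\<^sub>R (\<Phi> Q - \<Phi> P)) -` ball 0 r"
        by (auto simp: T_def y_def dist_norm)
      then show ?thesis by (simp add: convex_linear_vimage linear_iff scaleR_add_left)
    qed
    have y01: "y 0 = \<Phi> P" "y 1 = \<Phi> Q" by (auto simp: y_def)
    have T01: "0 \<in> T" "1 \<in> T" using Q r y01 by (auto simp: T_def N_def)
    have yV: "y t \<in> V" if "t \<in> T" for t using that r by (auto simp: T_def)
    have \<Psi>U: "\<Psi> (y t) \<in> U" "\<Phi> (\<Psi> (y t)) = y t" if "t \<in> T" for t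
      using yV[OF that] hom by (auto simp: homeomorphism_def)
    have der\<gamma>: "((\<lambda>t. \<Psi> (y t)) has_derivative (\<lambda>s. \<Psi>' (y t) (s *\<^sub>R (\<Phi> Q - \<Phi> P)))) (at t)" if "t \<in> T" for t
      using yV[OF that] unfolding y_def
      by (auto intro!: derivative_eq_intros has_derivative_compose[OF _ der\<Psi>])
    have tangent: "inner (G b (\<Psi> (y t))) (\<Psi>' (y t) (s *\<^sub>R (\<Phi> Q - \<Phi> P))) = 0"
      if "b \<in> B" "t \<in> T" for b t s
    proof -
      have "((\<lambda>t. h b (\<Psi> (y t))) has_derivative
          (\<lambda>s. inner (G b (\<Psi> (y t))) (\<Psi>' (y t) (s *\<^sub>R (\<Phi> Q - \<Phi> P))))) (at t)"
        using der[OF that(1), of "\<Psi> (y t)"] \<Psi>U(1)[OF that(2)] U(2)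
        by (intro has_derivative_compose[OF der\<gamma>[OF that(2)]]) auto
      moreover have "((\<lambda>t. h b (\<Psi> (y t))) has_derivative (\<lambda>s. 0)) (at t)"
      proof (rule has_derivative_transform_within_open[OF has_derivative_const T_open that(2)])
        fix t' assume t': "t' \<in> T"
        have "inner (G b P) (\<Phi> Q - \<Phi> P) = 0"
          using eq that h by (simp add: inner_diff_right)
        then show "h b P = h b (\<Psi> (y t'))"
          using h[OF that(1)] \<Psi>U(2)[OF t'] by (simp add: y_def inner_add_right)
      qed
      ultimately show ?thesis using has_derivative_unique by (metis (no_types, lifting))
    qed
    have "((\<lambda>t. g (\<Psi> (y t))) has_derivative (\<lambda>s. 0)) (at t within T)" if "t \<in> T" for t
    proof -
      have "inner (\<Gamma> (\<Psi> (y t))) (\<Psi>' (y t) (s *\<^sub>R (\<Phi> Q - \<Phi> P))) = 0" for s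
        using tangent[OF _ that] \<Psi>U(1)[OF that] U(2) by (intro inner_span_eq_0[OF dep]) auto
      moreover have "((\<lambda>t. g (\<Psi> (y t))) has_derivative
          (\<lambda>s. inner (\<Gamma> (\<Psi> (y t))) (\<Psi>' (y t) (s *\<^sub>R (\<Phi> Q - \<Phi> P))))) (at t)"
        using derg[of "\<Psi> (y t)"] \<Psi>U(1)[OF that] U(2)
        by (intro has_derivative_compose[OF der\<gamma>[OF that]]) auto
      ultimately show ?thesis by (simp add: has_derivative_at_withinI)
    qed
    then have "g (\<Psi> (y 1)) = g (\<Psi> (y 0))"
      using has_derivative_zero_unique[OF T_convex] T01 by metis
    moreover have "\<Psi> (\<Phi> Q) = Q" "\<Psi> (\<Phi> P) = P" using hom Q U by (auto simp: homeomorphism_def N_def)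
    ultimately show ?thesis using y01 by simp
  qed
  then show ?thesis using N by blast
qed

text \<open>
  Every direction orthogonal to the gradients is tangent to the level set: the curve is the preimage
  of a straight line in straightened coordinates, and the derivative of the coordinate change at
  \<open>P\<close> is the identity.
\<close>

lemma level_set_curve:
  fixes h :: "'k \<Rightarrow> 'a::euclidean_space \<Rightarrow> real" and G :: "'k \<Rightarrow> 'a \<Rightarrow> 'a"
  assumes B: "finite B" and W: "open W" "P \<in> W"
    and der: "\<And>b x. b \<in> B \<Longrightarrow> x \<in> W \<Longrightarrow> (h b has_derivative (\<lambda>v. inner (G b x) v)) (at x)"
    and cont: "\<And>b. b \<in> B \<Longrightarrow> continuous_on W (G b)"
    and ind: "independent_family (\<lambda>b. G b P) B"
    and v: "\<And>b. b \<in> B \<Longrightarrow> inner (G b P) v = 0"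
  obtains \<gamma> :: "real \<Rightarrow> 'a" where "\<gamma> 0 = P" "(\<gamma> has_derivative (\<lambda>s. s *\<^sub>R v)) (at 0)"
    "\<forall>\<^sub>F t in nhds 0. \<forall>b\<in>B. h b (\<gamma> t) = h b P"
proof -
  obtain U V \<Phi> \<Psi> \<Psi>' where U: "open U" "U \<subseteq> W" "P \<in> U" and V: "open V" and hom: "homeomorphism U V \<Phi> \<Psi>"
    and der\<Psi>: "\<And>y. y \<in> V \<Longrightarrow> (\<Psi> has_derivative \<Psi>' y) (at y)" "\<Psi>' (\<Phi> P) = id"
    and h: "\<And>b x. b \<in> B \<Longrightarrow> h b x = inner (G b P) (\<Phi> x)"
    using straighten_independent_functions[OF B W der cont ind] by metis
  have PV: "\<Phi> P \<in> V" using hom U by (auto simp: homeomorphism_def)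
  define y where "y t = \<Phi> P + t *\<^sub>R v" for t :: real
  have "(y has_derivative (\<lambda>s. s *\<^sub>R v)) (at 0)"
    unfolding y_def by (auto intro!: derivative_eq_intros)
  moreover have "(\<Psi> has_derivative id) (at (y 0))" using der\<Psi>(1)[OF PV] der\<Psi>(2) by (simp add: y_def)
  ultimately have "((\<lambda>t. \<Psi> (y t)) has_derivative (\<lambda>s. s *\<^sub>R v)) (at 0)"
    using has_derivative_compose by fastforce
  moreover have "\<Psi> (y 0) = P" using hom U by (simp add: homeomorphism_def y_def)
  moreover have "\<forall>\<^sub>F t in nhds 0. \<forall>b\<in>B. h b (\<Psi> (y t)) = h b P"
  proof -
    have "open (y -` V)" unfolding y_def using V by (intro open_vimage continuous_intros)
    then have "\<forall>\<^sub>F t in nhds 0. t \<in> y -` V"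
      using PV by (intro eventually_nhds_in_open) (auto simp: y_def)
    then show ?thesis
    proof (rule eventually_mono, intro ballI)
      fix t b assume t: "t \<in> y -` V" and b: "b \<in> B"
      then have "\<Phi> (\<Psi> (y t)) = y t" using hom by (auto simp: homeomorphism_def)
      then show "h b (\<Psi> (y t)) = h b P" using h[OF b] v[OF b] by (simp add: y_def inner_add_right)
    qed
  qed
  ultimately show ?thesis using that[of "\<lambda>t. \<Psi> (y t)"] by blast
qed

text \<open>
  Part of \<open>\<Gamma>\<close> is orthogonal to the gradients at \<open>P\<close>, so \<open>g\<close> has nonzero derivative along a curve
  in the level set of the \<open>h b\<close>, \<open>b \<in> B\<close>. The other functions \<open>h k\<close> stay constant on that curve
  because their gradients depend on those in \<open>B\<close> on all of \<open>W\<close>, not only at \<open>P\<close>.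
\<close>

lemma independent_function_varies_on_level_set:
  fixes h :: "'k \<Rightarrow> 'a::euclidean_space \<Rightarrow> real" and G :: "'k \<Rightarrow> 'a \<Rightarrow> 'a"
  assumes K: "finite K" "B \<subseteq> K" and W: "open W" "P \<in> W"
    and der: "\<And>k x. k \<in> K \<Longrightarrow> x \<in> W \<Longrightarrow> (h k has_derivative (\<lambda>v. inner (G k x) v)) (at x)"
    and cont: "\<And>k. k \<in> K \<Longrightarrow> continuous_on W (G k)"
    and ind: "independent_family (\<lambda>b. G b P) B"
    and dep: "\<And>k x. k \<in> K \<Longrightarrow> x \<in> W \<Longrightarrow> G k x \<in> span ((\<lambda>b. G b x) ` B)"
    and derg: "(g has_derivative (\<lambda>v. inner \<Gamma> v)) (at P)"
    and indg: "\<Gamma> \<notin> span ((\<lambda>b. G b P) ` B)"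
    and U: "open U" "P \<in> U"
  shows "\<exists>Q\<in>U. (\<forall>k\<in>K. h k Q = h k P) \<and> g Q \<noteq> g P"
proof -
  have B: "finite B" using K finite_subset by blast
  have "\<exists>N. open N \<and> P \<in> N \<and> (\<forall>Q\<in>N. (\<forall>b\<in>B. h b Q = h b P) \<longrightarrow> h k Q = h k P)" if "k \<in> K" for k
  proof (rule dependent_function_constant_on_level_set[OF B W, where h=h and G=G and g="h k" and \<Gamma>="G k"])
    show "(h b has_derivative (\<lambda>v. inner (G b x) v)) (at x)" if "b \<in> B" "x \<in> W" for b x
      using der that K by blast
    show "continuous_on W (G b)" if "b \<in> B" for b using cont that K by blast
  qed (use ind der[OF that] dep[OF that] in auto)
  then obtain N where "\<And>k. k \<in> K \<Longrightarrow> open (N k) \<and> P \<in> N k \<and>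
      (\<forall>Q\<in>N k. (\<forall>b\<in>B. h b Q = h b P) \<longrightarrow> h k Q = h k P)" by metis
  then have N: "\<And>k. k \<in> K \<Longrightarrow> open (N k)" "\<And>k. k \<in> K \<Longrightarrow> P \<in> N k"
    "\<And>k Q. k \<in> K \<Longrightarrow> Q \<in> N k \<Longrightarrow> \<forall>b\<in>B. h b Q = h b P \<Longrightarrow> h k Q = h k P" by blast+
  define N' where "N' = U \<inter> (\<Inter>k\<in>K. N k)"
  have N': "open N'" "P \<in> N'" unfolding N'_def using N U K by auto
  obtain v where v: "\<And>s. s \<in> span ((\<lambda>b. G b P) ` B) \<Longrightarrow> inner s v = 0" "inner \<Gamma> v \<noteq> 0"
    using vector_outside_span[OF indg] by metis
  have v': "b \<in> B \<Longrightarrow> inner (G b P) v = 0" for b by (intro v(1) span_base) auto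
  obtain \<gamma> :: "real \<Rightarrow> 'a" where \<gamma>: "\<gamma> 0 = P" "(\<gamma> has_derivative (\<lambda>s. s *\<^sub>R v)) (at 0)"
    "\<forall>\<^sub>F t in nhds 0. \<forall>b\<in>B. h b (\<gamma> t) = h b P"
  proof (rule level_set_curve[OF B W, where h=h and G=G and v=v])
    show "(h b has_derivative (\<lambda>v. inner (G b x) v)) (at x)" if "b \<in> B" "x \<in> W" for b x
      using der that K by blast
    show "continuous_on W (G b)" if "b \<in> B" for b using cont that K by blast
  qed (use ind v' in auto)
  show ?thesis
  proof (rule ccontr)
    assume "\<not> ?thesis"
    then have none: "g Q = g P" if "Q \<in> U" "\<forall>k\<in>K. h k Q = h k P" for Q using that by blast
    have "isCont \<gamma> 0" using \<gamma>(2) has_derivative_continuous by blast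
    then have "\<forall>\<^sub>F t in at 0. \<gamma> t \<in> N'"
      using N' \<gamma>(1) by (metis isCont_def topological_tendstoD)
    then have "\<forall>\<^sub>F t in nhds 0. \<gamma> t \<in> N'"
      using N' \<gamma>(1) by (simp add: eventually_nhds_conv_at)
    with \<gamma>(3) have "\<forall>\<^sub>F t in nhds 0. g (\<gamma> t) = g P"
      by eventually_elim (auto simp: N'_def intro!: none N(3))
    then have ev: "\<forall>\<^sub>F t in at 0. g (\<gamma> t) = g P" by (simp add: eventually_nhds_conv_at)
    have "((\<lambda>t. g (\<gamma> t)) has_derivative (\<lambda>s. inner \<Gamma> (s *\<^sub>R v))) (at 0)"
      using has_derivative_compose[OF \<gamma>(2), of g "\<lambda>v. inner \<Gamma> v"] derg by (simp only: \<gamma>(1))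
    then have "((\<lambda>_. g P) has_derivative (\<lambda>s. inner \<Gamma> (s *\<^sub>R v))) (at (0::real))"
      by (rule has_derivative_transform_eventually[OF _ ev]) (simp_all add: \<gamma>(1))
    then have "(\<lambda>s. inner \<Gamma> (s *\<^sub>R v)) = (\<lambda>s::real. 0)"
      by (rule has_derivative_unique[OF _ has_derivative_const])
    then have "inner \<Gamma> (1 *\<^sub>R v) = 0" by (rule fun_cong)
    then show False using v(2) by simp
  qed
qed

section \<open>The dichotomy for fibres of a rational map\<close>

text \<open>
  Generically, either every fibre of the map with homogeneous coordinates \<open>(f k : g k)\<close> is locally
  contained in a fibre of \<open>D\<close>, or none is. The alternative is read off from the gradients, whose
  pattern of linear dependence is constant off the zeros of a polynomial.
\<close>

lemma fibre_dichotomy: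
  fixes f g :: "'k \<Rightarrow> 'a::euclidean_space \<Rightarrow> real" and D :: "'j \<Rightarrow> 'a \<Rightarrow> real"
  assumes K: "finite K" and J: "finite J"
    and f: "\<And>k. k \<in> K \<Longrightarrow> real_polynomial_function (f k)"
    and g: "\<And>k. k \<in> K \<Longrightarrow> real_polynomial_function (g k)"
    and D: "\<And>j. j \<in> J \<Longrightarrow> real_polynomial_function (D j)"
  obtains q where "real_polynomial_function q" "\<exists>x. q x \<noteq> 0"
    "(\<forall>P. q P \<noteq> 0 \<longrightarrow> (\<exists>U. open U \<and> P \<in> U \<and>
        (\<forall>Q\<in>U. (\<forall>k\<in>K. f k P * g k Q = f k Q * g k P) \<longrightarrow> (\<forall>j\<in>J. D j P = D j Q)))) \<or>
     (\<forall>P. q P \<noteq> 0 \<longrightarrow> (\<forall>U. open U \<and> P \<in> U \<longrightarrow>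
        (\<exists>Q\<in>U. (\<forall>k\<in>K. f k P * g k Q = f k Q * g k P) \<and> (\<exists>j\<in>J. D j P \<noteq> D j Q))))"
proof -
  \<comment> \<open>If \<open>f k\<close> vanishes identically, the equation for \<open>k\<close> reads \<open>0 = 0\<close> and can be dropped.\<close>
  define K' where "K' = {k \<in> K. \<exists>x. f k x \<noteq> 0}"
  have K': "finite K'" "K' \<subseteq> K" using K by (auto simp: K'_def)
  define F where "F x = (\<Prod>k\<in>K'. f k x)" for x
  have F: "real_polynomial_function F" "\<exists>x. F x \<noteq> 0"
    unfolding F_def using K' f
    by (auto intro!: real_polynomial_function_prod prod_nonzero_polynomials simp del: prod_zero_iff)
      (auto simp: K'_def)
  have fnz: "f k x \<noteq> 0" if "F x \<noteq> 0" "k \<in> K'" for k x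
    using that K' by (simp add: F_def)
  have "\<exists>G. polynomial_function G \<and> (\<forall>x. (f k has_derivative (\<lambda>v. inner (G x) v)) (at x))" if "k \<in> K" for k
    using real_polynomial_function_gradient[OF f[OF that]] by metis
  then obtain f' where f': "\<And>k. k \<in> K \<Longrightarrow> polynomial_function (f' k)"
    "\<And>k x. k \<in> K \<Longrightarrow> (f k has_derivative (\<lambda>v. inner (f' k x) v)) (at x)" by metis
  have "\<exists>G. polynomial_function G \<and> (\<forall>x. (g k has_derivative (\<lambda>v. inner (G x) v)) (at x))" if "k \<in> K" for k
    using real_polynomial_function_gradient[OF g[OF that]] by metis
  then obtain g' where g': "\<And>k. k \<in> K \<Longrightarrow> polynomial_function (g' k)"
    "\<And>k x. k \<in> K \<Longrightarrow> (g k has_derivative (\<lambda>v. inner (g' k x) v)) (at x)" by metis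
  have "\<exists>G. polynomial_function G \<and> (\<forall>x. (D j has_derivative (\<lambda>v. inner (G x) v)) (at x))" if "j \<in> J" for j
    using real_polynomial_function_gradient[OF D[OF that]] by metis
  then obtain D' where D': "\<And>j. j \<in> J \<Longrightarrow> polynomial_function (D' j)"
    "\<And>j x. j \<in> J \<Longrightarrow> (D j has_derivative (\<lambda>v. inner (D' j x) v)) (at x)" by metis
  define w where "w k x = f k x *\<^sub>R g' k x - g k x *\<^sub>R f' k x" for k x
  have w: "polynomial_function (w k)" if "k \<in> K" for k
    unfolding w_def using f[OF that] g[OF that] f'(1)[OF that] g'(1)[OF that]
    by (intro polynomial_function_diff polynomial_function_mult) (auto simp: real_polynomial_function_eq)
  define h where "h k x = g k x / f k x" for k x
  define G where "G k x = (1 / (f k x)\<^sup>2) *\<^sub>R w k x" for k x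
  have h: "(h k has_derivative (\<lambda>v. inner (G k x) v)) (at x)" if "k \<in> K'" "F x \<noteq> 0" for k x
  proof -
    have k: "k \<in> K" "f k x \<noteq> 0" using that K' fnz by auto
    have "(\<lambda>v. inner (G k x) v) = (\<lambda>v. (inner (g' k x) v * f k x - g k x * inner (f' k x) v) / (f k x * f k x))"
      by (auto simp: G_def w_def inner_diff_left power2_eq_square fun_eq_iff mult.commute)
    then show ?thesis
      using has_derivative_divide'[OF g'(2)[OF k(1), of x] f'(2)[OF k(1), of x] k(2)]
      by (simp add: h_def[abs_def])
  qed
  have equiv: "(\<forall>k\<in>K. f k P * g k Q = f k Q * g k P) \<longleftrightarrow> (\<forall>k\<in>K'. h k Q = h k P)"
    if "F P \<noteq> 0" "F Q \<noteq> 0" for P Q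
  proof -
    have "(\<forall>k\<in>K. f k P * g k Q = f k Q * g k P) \<longleftrightarrow> (\<forall>k\<in>K'. f k P * g k Q = f k Q * g k P)"
      unfolding K'_def by (metis (mono_tags, lifting) mem_Collect_eq mult_zero_left)
    also have "\<dots> \<longleftrightarrow> (\<forall>k\<in>K'. h k Q = h k P)"
      using fnz that by (intro ball_cong) (auto simp: h_def field_simps)
    finally show ?thesis .
  qed
  \<comment> \<open>A maximal generically independent subfamily: adding any other \<open>w k\<close> makes it dependent at every
     point, so \<open>w k\<close> lies in the span wherever the subfamily is independent.\<close>
  define generic where "generic = {B. B \<subseteq> K' \<and> (\<exists>x. independent_family (\<lambda>b. w b x) B)}"
  have "finite generic" using K' by (auto simp: generic_def intro: finite_subset[of _ "Pow K'"])
  moreover have "{} \<in> generic" by (auto simp: generic_def independent_family_def)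
  ultimately obtain B where B: "B \<in> generic" and max: "\<And>C. C \<in> generic \<Longrightarrow> B \<subseteq> C \<Longrightarrow> B = C"
    using finite_has_maximal[of generic] by auto
  have BK: "B \<subseteq> K'" "finite B" using B K' by (auto simp: generic_def intro: finite_subset)
  have "\<exists>p. real_polynomial_function p \<and> (\<forall>x. p x \<noteq> 0 \<longleftrightarrow> independent_family (\<lambda>b. w b x) B)"
    using independence_polynomial[of B w] BK K' w by blast
  then obtain p where p: "real_polynomial_function p"
    and ind: "\<And>x. p x \<noteq> 0 \<longleftrightarrow> independent_family (\<lambda>b. w b x) B" by blast
  have dep: "w k x \<in> span ((\<lambda>b. w b x) ` B)" if "k \<in> K'" "p x \<noteq> 0" for k x
  proof (cases "k \<in> B")
    case True
    then show ?thesis by (auto intro: span_base)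
  next
    case False
    then have "insert k B \<notin> generic" using max[of "insert k B"] by auto
    then have "\<not> independent_family (\<lambda>b. w b x) (insert k B)"
      using that BK by (auto simp: generic_def)
    then show ?thesis using independent_family_insert[OF False, of "\<lambda>b. w b x"] ind[of x] that by auto
  qed
  define W where "W = {x. F x * p x \<noteq> 0}"
  have W: "open W"
    unfolding W_def using F p
    by (intro open_Collect_neq continuous_on_polymonial_function continuous_on_const)
      (auto simp: real_polynomial_function_eq[symmetric])
  have WF: "F x \<noteq> 0" "p x \<noteq> 0" if "x \<in> W" for x using that by (auto simp: W_def)
  have G_cont: "continuous_on W (G k)" if "k \<in> K'" for k
    unfolding G_def using that K' f w WF fnz
    by (intro continuous_intros continuous_on_polymonial_function)
      (auto simp: real_polynomial_function_eq[symmetric])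
  have G_span: "span ((\<lambda>b. G b x) ` B) = span ((\<lambda>b. w b x) ` B)" if "x \<in> W" for x
    unfolding G_def using BK fnz[OF WF(1)[OF that]] by (intro span_scaled_family) auto
  have G_ind: "independent_family (\<lambda>b. G b x) B" if "x \<in> W" for x
    unfolding G_def using BK fnz[OF WF(1)[OF that]] ind[of x] WF(2)[OF that]
    by (intro independent_family_scale) auto
  have G_dep: "G k x \<in> span ((\<lambda>b. G b x) ` B)" if "k \<in> K'" "x \<in> W" for k x
    unfolding G_span[OF that(2)] using that by (subst G_def) (intro span_scale dep WF)
  obtain a where a: "F a * p a \<noteq> 0"
  proof -
    obtain y z where "F y \<noteq> 0" "p z \<noteq> 0" using F(2) B ind by (auto simp: generic_def)
    then show ?thesis using nonzero_mult_polynomials[OF F(1) p] that by blast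
  qed
  show ?thesis
  proof (cases "\<forall>j\<in>J. \<forall>x\<in>W. D' j x \<in> span ((\<lambda>b. w b x) ` B)")
    case True
    have "\<exists>U. open U \<and> P \<in> U \<and> (\<forall>Q\<in>U. (\<forall>k\<in>K. f k P * g k Q = f k Q * g k P) \<longrightarrow> (\<forall>j\<in>J. D j P = D j Q))"
      if P: "P \<in> W" for P
    proof -
      have "\<exists>N. open N \<and> P \<in> N \<and> (\<forall>Q\<in>N. (\<forall>b\<in>B. h b Q = h b P) \<longrightarrow> D j Q = D j P)" if j: "j \<in> J" for j
      proof (rule dependent_function_constant_on_level_set[OF BK(2) W P, where h=h and G=G and g="D j" and \<Gamma>="D' j"])
        show "(h b has_derivative (\<lambda>v. inner (G b x) v)) (at x)" if "b \<in> B" "x \<in> W" for b x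
          using h BK WF that by blast
        show "continuous_on W (G b)" if "b \<in> B" for b using G_cont BK that by blast
        show "D' j x \<in> span ((\<lambda>b. G b x) ` B)" if "x \<in> W" for x
          using True j that G_span by auto
      qed (use G_ind P D' j in auto)
      then obtain N where "\<And>j. j \<in> J \<Longrightarrow> open (N j) \<and> P \<in> N j \<and>
          (\<forall>Q\<in>N j. (\<forall>b\<in>B. h b Q = h b P) \<longrightarrow> D j Q = D j P)" by metis
      then have N: "\<And>j. j \<in> J \<Longrightarrow> open (N j)" "\<And>j. j \<in> J \<Longrightarrow> P \<in> N j"
        "\<And>j Q. j \<in> J \<Longrightarrow> Q \<in> N j \<Longrightarrow> \<forall>b\<in>B. h b Q = h b P \<Longrightarrow> D j Q = D j P" by blast+
      show ?thesis
      proof (intro exI[of _ "W \<inter> (\<Inter>j\<in>J. N j)"] conjI ballI impI)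
        show "open (W \<inter> (\<Inter>j\<in>J. N j))" using W N J by auto
        show "P \<in> W \<inter> (\<Inter>j\<in>J. N j)" using P N by auto
      next
        fix Q j assume Q: "Q \<in> W \<inter> (\<Inter>j\<in>J. N j)" "\<forall>k\<in>K. f k P * g k Q = f k Q * g k P" and j: "j \<in> J"
        then have "\<forall>b\<in>B. h b Q = h b P" using equiv[of P Q] WF P BK by blast
        then show "D j P = D j Q" using N(3)[of j Q] Q j by auto
      qed
    qed
    then show ?thesis
      using a F p by (intro that[of "\<lambda>x. F x * p x"] real_polynomial_function.intros(4) disjI1) (auto simp: W_def)
  next
    case False
    then obtain j z where j: "j \<in> J" and z: "z \<in> W" "D' j z \<notin> span ((\<lambda>b. w b z) ` B)" by blast
    \<comment> \<open>The gradient of \<open>D j\<close> joins the family under the new index \<open>None\<close>; independence of the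
       enlarged family is again the nonvanishing of a polynomial, and it holds at \<open>z\<close>.\<close>
    define w' where "w' i = (case i of None \<Rightarrow> D' j | Some k \<Rightarrow> w k)" for i
    have img: "(\<lambda>i. w' i x) ` Some ` B = (\<lambda>b. w b x) ` B" for x by (auto simp: w'_def image_image)
    have ind_Some: "independent_family (\<lambda>i. w' i x) (Some ` B) \<longleftrightarrow> independent_family (\<lambda>b. w b x) B" for x
    proof
      assume "independent_family (\<lambda>i. w' i x) (Some ` B)"
      then obtain e where "\<forall>b\<in>Some ` B. \<forall>c\<in>Some ` B. inner (w' b x) (e c) = (if b = c then 1 else 0)"
        unfolding independent_family_def by blast
      then show "independent_family (\<lambda>b. w b x) B"
        unfolding independent_family_def by (intro exI[of _ "\<lambda>c. e (Some c)"]) (auto simp: w'_def)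
    next
      assume "independent_family (\<lambda>b. w b x) B"
      then obtain e where "\<forall>b\<in>B. \<forall>c\<in>B. inner (w b x) (e c) = (if b = c then 1 else 0)"
        unfolding independent_family_def by blast
      then show "independent_family (\<lambda>i. w' i x) (Some ` B)"
        unfolding independent_family_def by (intro exI[of _ "\<lambda>c. e (the c)"]) (auto simp: w'_def)
    qed
    have ind': "independent_family (\<lambda>i. w' i x) (insert None (Some ` B)) \<longleftrightarrow>
        p x \<noteq> 0 \<and> D' j x \<notin> span ((\<lambda>b. w b x) ` B)" for x
      using independent_family_insert[of None "Some ` B" "\<lambda>i. w' i x"] ind[of x] ind_Some[of x] img[of x]
      by (auto simp: w'_def)
    have "\<exists>r. real_polynomial_function r \<and>
        (\<forall>x. r x \<noteq> 0 \<longleftrightarrow> independent_family (\<lambda>i. w' i x) (insert None (Some ` B)))"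
    proof -
      have "polynomial_function (w' i)" if "i \<in> insert None (Some ` B)" for i
        using that j D' w BK K' by (auto simp: w'_def)
      then show ?thesis
        using independence_polynomial[of "insert None (Some ` B)" w'] BK by blast
    qed
    then obtain r where r: "real_polynomial_function r"
      "\<And>x. r x \<noteq> 0 \<longleftrightarrow> p x \<noteq> 0 \<and> D' j x \<notin> span ((\<lambda>b. w b x) ` B)"
      using ind' by auto
    have "\<exists>Q\<in>U. (\<forall>k\<in>K. f k P * g k Q = f k Q * g k P) \<and> (\<exists>j\<in>J. D j P \<noteq> D j Q)"
      if P: "F P * r P \<noteq> 0" and U: "open U" "P \<in> U" for P U
    proof -
      have PW: "P \<in> W" and DP: "D' j P \<notin> span ((\<lambda>b. G b P) ` B)"
        using P r(2)[of P] G_span[of P] by (auto simp: W_def)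
      have "\<exists>Q\<in>U \<inter> W. (\<forall>k\<in>K'. h k Q = h k P) \<and> D j Q \<noteq> D j P"
      proof (rule independent_function_varies_on_level_set[OF K'(1) BK(1) W PW,
            where h=h and G=G and g="D j" and \<Gamma>="D' j P" and U="U \<inter> W"])
        show "(h k has_derivative (\<lambda>v. inner (G k x) v)) (at x)" if "k \<in> K'" "x \<in> W" for k x
          using h WF that by blast
      qed (use G_cont G_ind G_dep D' j DP PW U W in auto)
      then obtain Q where Q: "Q \<in> U" "Q \<in> W" "\<forall>k\<in>K'. h k Q = h k P" "D j P \<noteq> D j Q" by force
      then have "\<forall>k\<in>K. f k P * g k Q = f k Q * g k P" using equiv[of P Q] WF PW by blast
      then show ?thesis using Q(1,4) j by blast
    qed
    moreover have "\<exists>x. F x * r x \<noteq> 0"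
      using z WF r(2)[of z] by (intro exI[of _ z]) auto
    ultimately show ?thesis
      using F r by (intro that[of "\<lambda>x. F x * r x"] real_polynomial_function.intros(4) disjI2) auto
  qed
qed

section \<open>Circumsphere frameworks\<close>

lemma real_polynomial_function_det:
  assumes A: "\<And>x. A x \<in> carrier_mat n n"
    and "\<And>i j. i < n \<Longrightarrow> j < n \<Longrightarrow> real_polynomial_function (\<lambda>x. A x $$ (i, j))"
  shows "real_polynomial_function (\<lambda>x. det (A x))"
  unfolding det_def'[OF A] using assms(2)
  by (intro real_polynomial_function_sum real_polynomial_function.intros(4) real_polynomial_function_prod
      finite_permutations real_polynomial_function.intros(2)) (auto dest: permutes_in_image)

lemma real_polynomial_function_squared_distance:
  "real_polynomial_function (\<lambda>P :: real^'d^'n. (norm (P $ i - P $ j))\<^sup>2)"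
  unfolding power2_norm_eq_inner
  by (intro real_polynomial_function_inner polynomial_function_bounded_linear
      bounded_linear_sub bounded_linear_vec_nth)

lemma open_PC: "open (PC :: (real^'d^'n) set)"
proof -
  have PC: "PC = (\<Inter>i. \<Inter>j\<in>-{i}. {P :: real^'d^'n. P $ i \<noteq> P $ j})" by (auto simp: PC_def)
  have "open {P :: real^'d^'n. P $ i \<noteq> P $ j}" for i j
    by (intro open_Collect_neq continuous_intros)
  then show ?thesis unfolding PC by (intro open_INT ballI) auto
qed

lemma length_subcloud [simp]: "length (subcloud \<sigma> P) = card \<sigma>"
  by (simp add: subcloud_def)

lemma nth_subcloud: "i < card \<sigma> \<Longrightarrow> subcloud \<sigma> P ! i = P $ (sorted_list_of_set \<sigma> ! i)"
  by (simp add: subcloud_def)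

lemma real_polynomial_function_det_euclidean_distance_matrix:
  "real_polynomial_function
     (\<lambda>P :: real^'d^'n::{finite,linorder}. det (euclidean_distance_matrix (subcloud \<sigma> P)))"
proof (rule real_polynomial_function_det[where n="card \<sigma>"])
  show "real_polynomial_function (\<lambda>P :: real^'d^'n::{finite,linorder}. euclidean_distance_matrix (subcloud \<sigma> P) $$ (i, j))"
    if "i < card \<sigma>" "j < card \<sigma>" for i j
    using that by (simp add: euclidean_distance_matrix_def nth_subcloud real_polynomial_function_squared_distance)
qed (simp add: euclidean_distance_matrix_def)

lemma real_polynomial_function_det_cayley_menger_matrix:
  "real_polynomial_function
     (\<lambda>P :: real^'d^'n::{finite,linorder}. det (cayley_menger_matrix (subcloud \<sigma> P)))"
proof (rule real_polynomial_function_det[where n="Suc (card \<sigma>)"])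
  show "real_polynomial_function (\<lambda>P :: real^'d^'n::{finite,linorder}. cayley_menger_matrix (subcloud \<sigma> P) $$ (i, j))"
    if "i < Suc (card \<sigma>)" "j < Suc (card \<sigma>)" for i j
    using that
    by (cases i; cases j)
      (auto simp: cayley_menger_matrix_def euclidean_distance_matrix_def nth_subcloud
        intro: real_polynomial_function_squared_distance)
qed (rule carrier_matI; simp add: cayley_menger_matrix_def euclidean_distance_matrix_def)

lemma congruent_clouds_iff_squared:
  "congruent_clouds P Q \<longleftrightarrow> (\<forall>i j. (norm (P $ i - P $ j))\<^sup>2 = (norm (Q $ i - Q $ j))\<^sup>2)"
  by (simp add: congruent_clouds_def)

text \<open>
  Equivalence of frameworks is membership in a common fibre, with \<open>f\<close> the Cayley--Menger determinants
  and \<open>g\<close> the distance determinants; congruence is equality of the squared distances, which unlike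
  the distances are polynomial. In the flexible case the neighbourhoods are intersected with the open
  set \<open>PC\<close>, so that the incongruent clouds found are frameworks.
\<close>

lemma locally_rigid_generic:
  fixes E :: "'n::{finite,linorder} set set"
  assumes "admissible_hyperedges TYPE('d::finite) E"
  shows "\<exists>q. real_polynomial_function q \<and> (\<exists>x. q x \<noteq> 0) \<and>
    ((\<forall>P\<in>PC. q P \<noteq> 0 \<longrightarrow> locally_rigid E P) \<or> (\<forall>P\<in>PC. q (P :: real^'d^'n::{finite,linorder}) \<noteq> 0 \<longrightarrow> \<not> locally_rigid E P))"
proof -
  define D where "D = (\<lambda>(i, j) P :: real^'d^'n::{finite,linorder}. (norm (P $ i - P $ j))\<^sup>2)"
  have D: "real_polynomial_function (D ij)" for ij
    by (cases ij) (simp add: D_def real_polynomial_function_squared_distance)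
  have congruent: "congruent_clouds P Q \<longleftrightarrow> (\<forall>ij\<in>UNIV. D ij P = D ij Q)" for P Q
    by (auto simp: congruent_clouds_iff_squared D_def)
  define f where "f = (\<lambda>\<sigma> P :: real^'d^'n::{finite,linorder}. det (cayley_menger_matrix (subcloud \<sigma> P)))"
  define g where "g = (\<lambda>\<sigma> P :: real^'d^'n::{finite,linorder}. det (euclidean_distance_matrix (subcloud \<sigma> P)))"
  have equivalent: "equivalent_frameworks E P Q \<longleftrightarrow> (\<forall>\<sigma>\<in>E. f \<sigma> P * g \<sigma> Q = f \<sigma> Q * g \<sigma> P)" for P Q
    by (simp add: equivalent_frameworks_def f_def g_def)
  have fg: "real_polynomial_function (f \<sigma>)" "real_polynomial_function (g \<sigma>)" for \<sigma>
    unfolding f_def g_def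
    by (rule real_polynomial_function_det_cayley_menger_matrix
        real_polynomial_function_det_euclidean_distance_matrix)+
  obtain q where q: "real_polynomial_function q" "\<exists>x. q x \<noteq> 0"
    and "(\<forall>P. q P \<noteq> 0 \<longrightarrow> (\<exists>U. open U \<and> P \<in> U \<and>
        (\<forall>Q\<in>U. (\<forall>\<sigma>\<in>E. f \<sigma> P * g \<sigma> Q = f \<sigma> Q * g \<sigma> P) \<longrightarrow> (\<forall>ij\<in>UNIV. D ij P = D ij Q)))) \<or>
     (\<forall>P. q P \<noteq> 0 \<longrightarrow> (\<forall>U. open U \<and> P \<in> U \<longrightarrow>
        (\<exists>Q\<in>U. (\<forall>\<sigma>\<in>E. f \<sigma> P * g \<sigma> Q = f \<sigma> Q * g \<sigma> P) \<and> (\<exists>ij\<in>UNIV. D ij P \<noteq> D ij Q))))"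
    by (rule fibre_dichotomy[where K=E and J=UNIV and D=D and f=f and g=g,
          OF finite_class.finite finite_class.finite fg D])
  then have dich: "(\<forall>P. q P \<noteq> 0 \<longrightarrow> (\<exists>U. open U \<and> P \<in> U \<and>
        (\<forall>Q\<in>U. equivalent_frameworks E P Q \<longrightarrow> congruent_clouds P Q))) \<or>
     (\<forall>P. q P \<noteq> 0 \<longrightarrow> (\<forall>U. open U \<and> P \<in> U \<longrightarrow>
        (\<exists>Q\<in>U. equivalent_frameworks E P Q \<and> \<not> congruent_clouds P Q)))"
    by (simp add: equivalent congruent)
  have rigid: "locally_rigid E P"
    if "\<exists>U. open U \<and> P \<in> U \<and> (\<forall>Q\<in>U. equivalent_frameworks E P Q \<longrightarrow> congruent_clouds P Q)"
    for P :: "real^'d^'n::{finite,linorder}"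
    using that unfolding locally_rigid_def by blast
  have flexible: "\<not> locally_rigid E P"
    if P: "P \<in> PC" and flex: "\<And>U. open U \<Longrightarrow> P \<in> U \<Longrightarrow>
        \<exists>Q\<in>U. equivalent_frameworks E P Q \<and> \<not> congruent_clouds P Q" for P :: "real^'d^'n::{finite,linorder}"
  proof
    assume "locally_rigid E P"
    then obtain U where U: "open U" "P \<in> U"
      "\<And>Q. Q \<in> U \<Longrightarrow> circumsphere_framework E Q \<Longrightarrow> equivalent_frameworks E P Q \<Longrightarrow> congruent_clouds P Q"
      unfolding locally_rigid_def by blast
    obtain Q where "Q \<in> U \<inter> PC" "equivalent_frameworks E P Q" "\<not> congruent_clouds P Q"
      using flex[of "U \<inter> PC"] U P open_PC by blast
    then show False using U(3)[of Q] assms by (simp add: circumsphere_framework_def)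
  qed
  from dich have "(\<forall>P\<in>PC. q P \<noteq> 0 \<longrightarrow> locally_rigid E P) \<or> (\<forall>P\<in>PC. q P \<noteq> 0 \<longrightarrow> \<not> locally_rigid E P)"
  proof (elim disjE)
    assume "\<forall>P. q P \<noteq> 0 \<longrightarrow> (\<exists>U. open U \<and> P \<in> U \<and>
        (\<forall>Q\<in>U. equivalent_frameworks E P Q \<longrightarrow> congruent_clouds P Q))"
    then show ?thesis by (intro disjI1 ballI impI rigid) simp
  next
    assume "\<forall>P. q P \<noteq> 0 \<longrightarrow> (\<forall>U. open U \<and> P \<in> U \<longrightarrow>
        (\<exists>Q\<in>U. equivalent_frameworks E P Q \<and> \<not> congruent_clouds P Q))"
    then show ?thesis by (intro disjI2 ballI impI flexible) simp_all
  qed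
  then show ?thesis using q by blast
qed

theorem lemma64:
  shows "\<exists>V :: (real^'d^'n::{finite,linorder}) set.
    openin (subtopology zariski PC) V \<and> PC \<subseteq> closure V \<and>
    (\<forall>E. admissible_hyperedges TYPE('d) E \<longrightarrow>
      (\<forall>P\<in>V. circumsphere_framework E P \<longrightarrow> locally_rigid E P) \<or>
      (\<forall>P\<in>V. circumsphere_framework E P \<longrightarrow> \<not> locally_rigid E P))"
proof -
  let ?\<H> = "{E :: 'n set set. admissible_hyperedges TYPE('d) E}"
  have "\<forall>E\<in>?\<H>. \<exists>q :: real^'d^'n::{finite,linorder} \<Rightarrow> real. real_polynomial_function q \<and> (\<exists>x. q x \<noteq> 0) \<and>
      ((\<forall>P\<in>PC. q P \<noteq> 0 \<longrightarrow> locally_rigid E P) \<or> (\<forall>P\<in>PC. q P \<noteq> 0 \<longrightarrow> \<not> locally_rigid E P))"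
    using locally_rigid_generic by blast
  from bchoice[OF this] obtain q :: "'n set set \<Rightarrow> real^'d^'n::{finite,linorder} \<Rightarrow> real" where
    "\<forall>E\<in>?\<H>. real_polynomial_function (q E) \<and> (\<exists>x. q E x \<noteq> 0) \<and>
      ((\<forall>P\<in>PC. q E P \<noteq> 0 \<longrightarrow> locally_rigid E P) \<or> (\<forall>P\<in>PC. q E P \<noteq> 0 \<longrightarrow> \<not> locally_rigid E P))" ..
  then have q: "\<And>E. E \<in> ?\<H> \<Longrightarrow> real_polynomial_function (q E)" "\<And>E. E \<in> ?\<H> \<Longrightarrow> \<exists>x. q E x \<noteq> 0"
    and dich: "\<And>E. E \<in> ?\<H> \<Longrightarrow> (\<forall>P\<in>PC. q E P \<noteq> 0 \<longrightarrow> locally_rigid E P) \<or>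
      (\<forall>P\<in>PC. q E P \<noteq> 0 \<longrightarrow> \<not> locally_rigid E P)"
    by blast+
  define p where "p P = (\<Prod>E\<in>?\<H>. q E P)" for P
  have p: "real_polynomial_function p"
    unfolding p_def using q by (intro real_polynomial_function_prod) auto
  have "\<exists>x. p x \<noteq> 0"
    unfolding p_def using q by (intro prod_nonzero_polynomials) auto
  then have dense: "closure {P. p P \<noteq> 0} = UNIV" using closure_nonzero_polynomial[OF p] by blast
  show ?thesis
  proof (intro exI[of _ "PC \<inter> {P. p P \<noteq> 0}"] conjI allI impI)
    show "openin (subtopology zariski PC) (PC \<inter> {P. p P \<noteq> 0})"
      unfolding openin_subtopology openin_zariski
      by (intro exI[of _ "{P. p P \<noteq> 0}"] conjI exI[of _ "{p}"]) (use p in auto)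
    show "PC \<subseteq> closure (PC \<inter> {P. p P \<noteq> 0})"
      using open_Int_closure_subset[OF open_PC, of "{P. p P \<noteq> 0}"] dense by simp
  next
    fix E :: "'n set set" assume E: "admissible_hyperedges TYPE('d) E"
    have "q E P \<noteq> 0" if "p P \<noteq> 0" for P
      using that E by (auto simp: p_def)
    then show "(\<forall>P\<in>PC \<inter> {P. p P \<noteq> 0}. circumsphere_framework E P \<longrightarrow> locally_rigid E P) \<or>
        (\<forall>P\<in>PC \<inter> {P. p P \<noteq> 0}. circumsphere_framework E P \<longrightarrow> \<not> locally_rigid E P)"
      using dich[of E] E by blast
  qed
qed

end
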